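(* Let $K\subset\mathbb{C}\setminus\{0\}$ and $L\subset\mathbb{C}$ be two disjoint compact sets with connected complement. Let also $U\subset\mathbb{C}$ be a bounded open set containing $K$. Then there exist $\tau\ge 1$, $\theta\in(0,1)$ and $N\in\mathbb{N}$ such that for every $\varphi\in A(\overline{U})$ and every $n\ge N$, there exists a polynomial $P_n$ of the form $P_n(z)=\sum_{k=\lfloor n/\tau\rfloor}^{n}a_kz^k$ (with $a_k\in\mathbb{C}$) such that $$\|P_n\|_L\le\|\varphi\|_{\overline{U}}\,\theta^n\quad\text{and}\quad\|P_n-\varphi\|_K\le\|\varphi\|_{\overline{U}}\,\theta^n.$$
   Context: $\mathbb{N}$ is the set of non-negative integers, and $\lfloor x\rfloor$ is the integer part of $x$. "With connected complement" means that each of $\mathbb{C}\setminus K$ and $\mathbb{C}\setminus L$ is connected. For a compact set $X\subset\mathbb{C}$, $A(X)$ is the space of complex functions continuous on $X$ and holomorphic in the interior of $X$, and $\|\cdot\|_X$ is the supremum norm on $X$. *)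

theory Defs
  imports "HOL-Complex_Analysis.Complex_Analysis" "HOL-Computational_Algebra.Polynomial"
begin

text \<open>
  \<open>A(X)\<close>: functions are total in HOL, so membership constrains only the values on \<open>X\<close>.
\<close>

definition A_space :: "complex set \<Rightarrow> (complex \<Rightarrow> complex) set" where
  "A_space X = {f. continuous_on X f \<and> f holomorphic_on interior X}"

text \<open>
  The supremum norm on a compact set \<open>X\<close>, for functions continuous on \<open>X\<close>. The supremum of
  the empty set of reals is unspecified in HOL, hence the separate (usual) convention for
  \<open>X = {}\<close>.
\<close>

definition sup_norm :: "complex set \<Rightarrow> (complex \<Rightarrow> complex) \<Rightarrow> real" where
  "sup_norm X f = (if X = {} then 0 else (SUP z\<in>X. norm (f z)))"

end

theory Submission
  imports Defs
begin

text \<open>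
  Fix a cycle \<open>\<Gamma>\<close> around \<open>K\<close> in \<open>U - L - {0}\<close>. Cauchy's formula over \<open>\<Gamma>\<close> applied to
  \<open>f(w) = \<phi>(w) / w\<^sup>m\<close> gives \<open>f\<close> on \<open>K\<close> and \<open>0\<close> on \<open>L\<close>. As \<open>K \<union> L\<close> does not separate the plane,
  every point \<open>w\<^sub>0\<close> of \<open>\<Gamma>\<close> has a polynomial \<open>p\<close> with \<open>p(w\<^sub>0) = 1\<close> and \<open>\<bar>p\<bar> \<le> 1/4\<close> on
  \<open>K \<union> L\<close>. On a short piece of \<open>\<Gamma>\<close> around \<open>w\<^sub>0\<close>, replacing the kernel \<open>1 / (w - z)\<close> by
  \<open>(1 - (p(z) / p(w))\<^sup>k) / (w - z)\<close>, a polynomial in \<open>z\<close> of degree below \<open>k deg p\<close>, costs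
  \<open>O(2\<^sup>-\<^sup>k)\<close>. Multiplying the resulting polynomial by \<open>z\<^sup>m\<close> loses a factor exponential in \<open>m\<close>,
  which the geometric rate absorbs once \<open>m \<le> n/\<tau>\<close> with \<open>\<tau>\<close> large.
\<close>

section \<open>Polynomials equal to 1 at a point and small on a compact set\<close>

text \<open>Powers of \<open>p\<close> keep the value 1 at \<open>w\<close>. By compactness the
  maximum of |p| on \<open>E\<close> is attained, so it is below 1 and its powers tend to 0.\<close>

lemma poly_eq_1_power:
  fixes E :: "complex set"
  assumes "compact E" "poly p w = 1" "\<And>z. z \<in> E \<Longrightarrow> norm (poly p z) < 1" "e > 0"
  shows "\<exists>q. poly q w = 1 \<and> (\<forall>z\<in>E. norm (poly q z) \<le> e)"
proof (cases "E = {}")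
  case True
  then show ?thesis using assms(2) by auto
next
  case False
  have "continuous_on E (\<lambda>z. norm (poly p z))"
    by (intro continuous_intros)
  then obtain x where x: "x \<in> E" "\<And>z. z \<in> E \<Longrightarrow> norm (poly p z) \<le> norm (poly p x)"
    using continuous_attains_sup[OF assms(1) False] by blast
  obtain k where k: "norm (poly p x) ^ k < e"
    using real_arch_pow_inv[OF assms(4) assms(3)[OF x(1)]] by blast
  have "norm (poly (p ^ k) z) \<le> e" if "z \<in> E" for z
    using power_mono[OF x(2)[OF that], of k] k by (simp add: poly_power norm_power)
  then show ?thesis
    using assms(2) by (intro exI[of _ "p ^ k"]) (simp add: poly_power)
qed

text \<open>
  If \<open>poly p w = 1\<close> then \<open>(z - w) q(z) = 1 - p(z)\<close>, so \<open>q\<close> is nearly the inverse of \<open>z - w\<close> on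
  \<open>E\<close> when \<open>p\<close> is small there, and \<open>(w' - w) q + p\<close> equals \<open>1\<close> at \<open>w'\<close>.
\<close>
lemma poly_separation_step:
  fixes E :: "complex set"
  assumes "compact E" "poly p w = 1" "\<And>z. z \<in> E \<Longrightarrow> norm (poly p z) < 1"
    and d: "\<And>z. z \<in> E \<Longrightarrow> d \<le> dist w z" and w': "dist w w' < d / 2"
  shows "\<exists>p'. poly p' w' = 1 \<and> (\<forall>z\<in>E. norm (poly p' z) < 1)"
proof -
  have d0: "d > 0" using w' zero_le_dist[of w w'] by linarith
  \<comment> \<open>Since \<open>w'\<close> is within \<open>d / 2\<close> of \<open>w\<close>, the
    new polynomial is bounded on \<open>E\<close> by (1 + c)/2 + c, where c bounds
    \<open>p0\<close>. Any c below 1/3 makes this less than 1.\<close>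
  obtain p0 where p0: "poly p0 w = 1" "\<And>z. z \<in> E \<Longrightarrow> norm (poly p0 z) \<le> 1/16"
    using poly_eq_1_power[OF assms(1-3), of "1/16"] by auto
  have "[:-w, 1:] dvd 1 - p0"
    using p0(1) by (simp add: poly_eq_0_iff_dvd[symmetric])
  then obtain q where q: "1 - p0 = [:-w, 1:] * q" by (auto elim: dvdE)
  have qz: "(z - w) * poly q z = 1 - poly p0 z" for z
    using arg_cong[OF q, of "\<lambda>p. poly p z"] by (simp add: algebra_simps)
  define p' where "p' = smult (w' - w) q + p0"
  have "poly p' w' = 1"
    using qz[of w'] by (simp add: p'_def)
  moreover have "norm (poly p' z) < 1" if z: "z \<in> E" for z
  proof -
    have "dist w z * norm (poly q z) = norm (1 - poly p0 z)"
      using arg_cong[OF qz[of z], of norm] by (simp add: norm_mult dist_norm norm_minus_commute)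
    also have "\<dots> \<le> 1 + 1/16"
      using norm_triangle_ineq4[of 1 "poly p0 z"] p0(2)[OF z] by simp
    finally have "dist w z * norm (poly q z) \<le> 17/16" by simp
    then have "d * norm (poly q z) \<le> 17/16"
      using mult_right_mono[OF d[OF z], of "norm (poly q z)"] by simp
    moreover have "norm (w' - w) * norm (poly q z) \<le> (d / 2) * norm (poly q z)"
      using w' by (intro mult_right_mono) (auto simp: dist_norm norm_minus_commute)
    ultimately have "norm (w' - w) * norm (poly q z) \<le> 17/32" by simp
    moreover have "norm (poly p' z) \<le> norm (w' - w) * norm (poly q z) + norm (poly p0 z)"
      unfolding p'_def by (simp add: norm_mult[symmetric] norm_triangle_ineq)
    ultimately show ?thesis using p0(2)[OF z] by linarith
  qed
  ultimately show ?thesis by blast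
qed

text \<open>Connectedness replaces an explicit construction. \<open>poly_separation_step\<close>
  moves the distinguished point by a fixed fraction of its distance to \<open>E\<close>, so the set
  \<open>W\<close> of separable points is open and closed relative to \<open>- E\<close>. It is
  nonempty, hence all of \<open>- E\<close>.\<close>

lemma poly_separation:
  fixes E :: "complex set"
  assumes E: "compact E" and conn: "connected (- E)" and w: "w \<notin> E"
  shows "\<exists>p. poly p w = 1 \<and> (\<forall>z\<in>E. norm (poly p z) < 1)"
proof -
  define W where "W = {w. \<exists>p. poly p w = 1 \<and> (\<forall>z\<in>E. norm (poly p z) < 1)}"
  have step: "w' \<in> W" if "v \<in> W" "\<And>z. z \<in> E \<Longrightarrow> d \<le> dist v z" "dist v w' < d / 2" for v w' d
    using poly_separation_step[OF E _ _ that(2,3)] that(1) by (auto simp: W_def)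
  have WE: "W \<inter> E = {}" by (auto simp: W_def)
  have sep: "\<exists>d>0. \<forall>z\<in>E. d \<le> dist v z" if "v \<notin> E" for v
    using separate_point_closed[OF compact_imp_closed[OF E] that] by blast
  have "open W"
    unfolding open_dist
  proof
    fix v assume v: "v \<in> W"
    then obtain d where "d > 0" "\<And>z. z \<in> E \<Longrightarrow> d \<le> dist v z"
      using sep WE by blast
    then show "\<exists>e>0. \<forall>y. dist y v < e \<longrightarrow> y \<in> W"
      using step[OF v] by (intro exI[of _ "d/2"]) (auto simp: dist_commute)
  qed
  \<comment> \<open>A point \<open>y\<close> within d/4 of \<open>v\<close> has distance at least
    3d/4 from \<open>E\<close>. The step from \<open>y\<close> then reaches every point within 3d/8,
    in particular \<open>v\<close>, so \<open>y\<close> in \<open>W\<close> would force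
    \<open>v\<close> into \<open>W\<close>.\<close>
  moreover have "open (- E - W)"
    unfolding open_dist
  proof
    fix v assume v: "v \<in> - E - W"
    then obtain d where d: "d > 0" "\<And>z. z \<in> E \<Longrightarrow> d \<le> dist v z"
      using sep by blast
    have "y \<in> - E - W" if y: "dist y v < d / 4" for y
    proof -
      have "y \<notin> E" using d y by (force simp: dist_commute)
      moreover have "y \<notin> W"
      proof
        assume yW: "y \<in> W"
        have "d * 3/4 \<le> dist y z" if "z \<in> E" for z
          using d(2)[OF that] y dist_triangle[of v z y] by (simp add: dist_commute)
        then have "v \<in> W" using step[OF yW, of "d * 3/4" v] y d(1) by auto
        then show False using v by simp
      qed
      ultimately show ?thesis by blast
    qed
    then show "\<exists>e>0. \<forall>y. dist y v < e \<longrightarrow> y \<in> - E - W"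
      using d(1) by (intro exI[of _ "d/4"]) auto
  qed
  moreover have "W \<noteq> {}"
  proof -
    obtain B where B: "B > 0" "\<And>z. z \<in> E \<Longrightarrow> norm z < B"
      using compact_imp_bounded[OF E] by (auto simp: bounded_pos_less)
    \<comment> \<open>Far away the linear polynomial z/B suffices.\<close>
    have "of_real B \<in> W"
      unfolding W_def using B
      by (intro CollectI exI[of _ "[:0, 1 / of_real B:]"]) (auto simp: norm_divide)
    then show ?thesis by blast
  qed
  ultimately have "- E \<subseteq> W"
    using connectedD[OF conn, of W "- E - W"] WE by blast
  then show ?thesis using w by (auto simp: W_def)
qed

section \<open>Expansion of difference quotients of polynomials\<close>

text \<open>Expanding in powers of \<open>z\<close> with coefficients depending on \<open>w\<close>
  lets an integration over \<open>w\<close> leave a polynomial in \<open>z\<close> of degree below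
  \<open>n\<close>. The induction uses w p(w) - z p(z) = (w - z) p(w) + z (p(w) - p(z)), which
  shifts the coefficients by one place.\<close>

lemma poly_diff_quotient:
  fixes p :: "complex poly"
  assumes "degree p \<le> n"
  shows "\<exists>q :: nat \<Rightarrow> complex poly.
    \<forall>w z. poly p w - poly p z = (w - z) * (\<Sum>i<n. poly (q i) w * z ^ i)"
  using assms
proof (induction p arbitrary: n rule: pCons_induct)
  case 0
  show ?case by (intro exI[of _ "\<lambda>_. 0"]) simp
next
  case (pCons a p)
  show ?case
  proof (cases "p = 0")
    case True
    then show ?thesis by (intro exI[of _ "\<lambda>_. 0"]) simp
  next
    case False
    then obtain m where m: "n = Suc m" "degree p \<le> m"
      using pCons.prems by (cases n) auto
    obtain q where q: "poly p w - poly p z = (w - z) * (\<Sum>i<m. poly (q i) w * z ^ i)" for w z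
      using pCons.IH[OF m(2)] by blast
    define q' where "q' i = (case i of 0 \<Rightarrow> p | Suc j \<Rightarrow> q j)" for i
    have "poly (pCons a p) w - poly (pCons a p) z
        = (w - z) * (\<Sum>i<n. poly (q' i) w * z ^ i)" for w z
    proof -
      have "poly (pCons a p) w - poly (pCons a p) z
          = (w - z) * poly p w + z * (poly p w - poly p z)"
        by (simp add: algebra_simps)
      also have "\<dots> = (w - z) * (poly p w + (\<Sum>i<m. poly (q i) w * z ^ Suc i))"
        unfolding q by (simp add: algebra_simps sum_distrib_left)
      also have "poly p w + (\<Sum>i<m. poly (q i) w * z ^ Suc i) = (\<Sum>i<n. poly (q' i) w * z ^ i)"
        unfolding m(1) by (simp add: sum.lessThan_Suc_shift q'_def del: sum.lessThan_Suc)
      finally show ?thesis .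
    qed
    then show ?thesis by blast
  qed
qed

section \<open>Operators approximable by polynomials at a geometric rate\<close>

text \<open>The order of quantifiers is essential: \<open>C\<close> and \<open>\<rho>\<close>
  precede \<open>f\<close>, \<open>M\<close> and \<open>n\<close>, whereas the coefficients may
  depend on all three. This uniformity later permits an \<open>f\<close> that itself varies with
  \<open>n\<close>, and constants that do not depend on the function to be approximated.\<close>

definition geom_approx ::
    "complex set \<Rightarrow> complex set \<Rightarrow> ((complex \<Rightarrow> complex) \<Rightarrow> complex \<Rightarrow> complex) \<Rightarrow> bool" where
  "geom_approx S E T \<longleftrightarrow> (\<exists>C \<rho>. 0 \<le> C \<and> 0 < \<rho> \<and> \<rho> < 1 \<and>
    (\<forall>f M n. continuous_on S f \<longrightarrow> (\<forall>w\<in>S. norm (f w) \<le> M) \<longrightarrow> 0 \<le> M \<longrightarrow>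
      (\<exists>c. \<forall>z\<in>E. norm (T f z - (\<Sum>i<n. c i * z ^ i)) \<le> C * M * \<rho> ^ n)))"

lemma geom_approxI:
  assumes "0 \<le> C" "0 < \<rho>" "\<rho> < 1"
    and "\<And>f M n. \<lbrakk>continuous_on S f; \<And>w. w \<in> S \<Longrightarrow> norm (f w) \<le> M; 0 \<le> M\<rbrakk> \<Longrightarrow>
      \<exists>c. \<forall>z\<in>E. norm (T f z - (\<Sum>i<n. c i * z ^ i)) \<le> C * M * \<rho> ^ n"
  shows "geom_approx S E T"
  unfolding geom_approx_def
  by (rule exI[of _ C], rule exI[of _ \<rho>]) (simp add: assms)

lemma geom_approxE:
  assumes "geom_approx S E T"
  obtains C \<rho> where "0 \<le> C" "0 < \<rho>" "\<rho> < 1"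
    and "\<And>f M n. \<lbrakk>continuous_on S f; \<And>w. w \<in> S \<Longrightarrow> norm (f w) \<le> M; 0 \<le> M\<rbrakk> \<Longrightarrow>
      \<exists>c. \<forall>z\<in>E. norm (T f z - (\<Sum>i<n. c i * z ^ i)) \<le> C * M * \<rho> ^ n"
  using assms unfolding geom_approx_def by (elim exE conjE) simp

text \<open>Equality is asked for continuous \<open>f\<close> only, because splitting an integral at
  a point of a segment relies on continuity.\<close>

lemma geom_approx_cong:
  assumes "geom_approx S E T" "\<And>f z. continuous_on S f \<Longrightarrow> z \<in> E \<Longrightarrow> T f z = T' f z"
  shows "geom_approx S E T'"
  using assms unfolding geom_approx_def by simp

lemma geom_approx_0: "geom_approx S E (\<lambda>f z. 0)"
  unfolding geom_approx_def
  by (intro exI[of _ 0] exI[of _ "1/2"] conjI allI impI exI[of _ "\<lambda>_. 0"]) auto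

lemma geom_approx_add:
  assumes "geom_approx S E T" "geom_approx S E T'"
  shows "geom_approx S E (\<lambda>f z. T f z + T' f z)"
proof -
  obtain C \<rho> where 1: "0 \<le> C" "0 < \<rho>" "\<rho> < 1"
    and T: "\<And>f M n. \<lbrakk>continuous_on S f; \<And>w. w \<in> S \<Longrightarrow> norm (f w) \<le> M; 0 \<le> M\<rbrakk> \<Longrightarrow>
      \<exists>c. \<forall>z\<in>E. norm (T f z - (\<Sum>i<n. c i * z ^ i)) \<le> C * M * \<rho> ^ n"
    using assms(1) by (rule geom_approxE) blast
  obtain C' \<rho>' where 2: "0 \<le> C'" "0 < \<rho>'" "\<rho>' < 1"
    and T': "\<And>f M n. \<lbrakk>continuous_on S f; \<And>w. w \<in> S \<Longrightarrow> norm (f w) \<le> M; 0 \<le> M\<rbrakk> \<Longrightarrow>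
      \<exists>c. \<forall>z\<in>E. norm (T' f z - (\<Sum>i<n. c i * z ^ i)) \<le> C' * M * \<rho>' ^ n"
    using assms(2) by (rule geom_approxE) blast
  define r where "r = max \<rho> \<rho>'"
  have "\<exists>c. \<forall>z\<in>E. norm (T f z + T' f z - (\<Sum>i<n. c i * z ^ i)) \<le> (C + C') * M * r ^ n"
    if f: "continuous_on S f" "\<And>w. w \<in> S \<Longrightarrow> norm (f w) \<le> M" "0 \<le> M" for f M n
  proof -
    obtain c where c: "\<And>z. z \<in> E \<Longrightarrow> norm (T f z - (\<Sum>i<n. c i * z ^ i)) \<le> C * M * \<rho> ^ n"
      using T[OF f] by blast
    obtain c' where c': "\<And>z. z \<in> E \<Longrightarrow> norm (T' f z - (\<Sum>i<n. c' i * z ^ i)) \<le> C' * M * \<rho>' ^ n"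
      using T'[OF f] by blast
    have "norm (T f z + T' f z - (\<Sum>i<n. (c i + c' i) * z ^ i)) \<le> (C + C') * M * r ^ n"
      if z: "z \<in> E" for z
    proof -
      have "norm (T f z + T' f z - (\<Sum>i<n. (c i + c' i) * z ^ i))
          = norm ((T f z - (\<Sum>i<n. c i * z ^ i)) + (T' f z - (\<Sum>i<n. c' i * z ^ i)))"
        by (simp add: algebra_simps sum.distrib)
      also have "\<dots> \<le> C * M * \<rho> ^ n + C' * M * \<rho>' ^ n"
        using norm_triangle_mono[OF c[OF z] c'[OF z]] .
      also have "\<dots> \<le> C * M * r ^ n + C' * M * r ^ n"
        using 1 2 f(3) by (intro add_mono mult_left_mono power_mono) (auto simp: r_def)
      finally show ?thesis by (simp add: algebra_simps)
    qed
    then show ?thesis by (intro exI[of _ "\<lambda>i. c i + c' i"]) simp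
  qed
  then show ?thesis
    using 1 2 by (intro geom_approxI[of "C + C'" r]) (auto simp: r_def)
qed

text \<open>Here |p(z)/p(w)| is at most (1/4)/(1/2) = 1/2, so the modified kernel differs from 1/(w
  - z) by at most 2^-k / e, where \<open>e\<close> separates the segment from \<open>E\<close>. The
  degree constraint allows k of about n/D, and this gives the rate.\<close>

lemma geom_approx_segment_local:
  assumes S: "closed_segment a b \<subseteq> S" and E: "compact E" "closed_segment a b \<inter> E = {}"
    and pw: "\<And>w. w \<in> closed_segment a b \<Longrightarrow> 1/2 \<le> norm (poly p w)"
    and pz: "\<And>z. z \<in> E \<Longrightarrow> norm (poly p z) \<le> 1/4"
  shows "geom_approx S E (\<lambda>f z. contour_integral (linepath a b) (\<lambda>w. f w / (w - z)))"
proof -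
  let ?s = "closed_segment a b"
  obtain e where e: "e > 0" "\<And>w z. w \<in> ?s \<Longrightarrow> z \<in> E \<Longrightarrow> e \<le> dist w z"
    using separate_compact_closed[of ?s E] E compact_imp_closed[OF E(1)] by auto
  \<comment> \<open>The successor keeps \<open>D\<close> positive even for constant
    \<open>p\<close>, so that division by \<open>D\<close> and the root of order \<open>D\<close>
    make sense. The choice of \<open>\<rho>\<close> turns 2^-k into a power of \<open>\<rho>\<close>
    with exponent kD.\<close>
  define D where "D = Suc (degree p)"
  define \<rho> where "\<rho> = root D (1/2)"
  have \<rho>: "0 < \<rho>" "\<rho> < 1" "\<rho> ^ D = 1/2"
    by (simp_all add: \<rho>_def D_def del: power_Suc)
  define C where "C = 2 * norm (b - a) / e"
  have "\<exists>c. \<forall>z\<in>E. norm (contour_integral (linepath a b) (\<lambda>w. f w / (w - z))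
        - (\<Sum>i<n. c i * z ^ i)) \<le> C * M * \<rho> ^ n"
    if f: "continuous_on S f" and M: "\<And>w. w \<in> S \<Longrightarrow> norm (f w) \<le> M" "0 \<le> M" for f M n
  proof -
    define k where "k = n div D"
    have kn: "k * D \<le> n" "n \<le> k * D + D"
      using div_times_less_eq_dividend[of n D] dividend_less_times_div[of D n]
      by (auto simp: k_def D_def mult.commute)
    have "degree (p ^ k) \<le> n"
      using degree_power_le[of p k] kn(1) by (auto simp: D_def mult.commute)
    then obtain q where q: "\<And>w z. poly (p ^ k) w - poly (p ^ k) z
        = (w - z) * (\<Sum>i<n. poly (q i) w * z ^ i)"
      using poly_diff_quotient by blast
    \<comment> \<open>Division by p(w)^k splits f(w)/(w - z) into the sum of the
      \<open>g i w * z ^ i\<close> and the error term \<open>R w\<close> below. The integrals of the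
      \<open>g i\<close> are the coefficients sought.\<close>
    define g where "g i w = f w / poly p w ^ k * poly (q i) w" for i w
    have fs: "continuous_on ?s f"
      using f S continuous_on_subset by blast
    have p0: "poly p w \<noteq> 0" if "w \<in> ?s" for w
      using pw[OF that] by auto
    have g: "g i contour_integrable_on linepath a b" for i
      unfolding g_def using fs p0
      by (intro contour_integrable_continuous_linepath continuous_intros) auto
    have "norm (contour_integral (linepath a b) (\<lambda>w. f w / (w - z))
        - (\<Sum>i<n. contour_integral (linepath a b) (g i) * z ^ i)) \<le> C * M * \<rho> ^ n"
      if z: "z \<in> E" for z
    proof -
      have wz: "w \<noteq> z" if "w \<in> ?s" for w using that z E(2) by auto
      define R where "R w = f w * (poly p z / poly p w) ^ k / (w - z)" for w
      have "R contour_integrable_on linepath a b"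
        unfolding R_def using fs p0 wz
        by (intro contour_integrable_continuous_linepath continuous_intros) auto
      then have R: "(R has_contour_integral contour_integral (linepath a b) R) (linepath a b)"
        by (rule has_contour_integral_integral)
      have "((\<lambda>w. (\<Sum>i<n. g i w * z ^ i) + R w) has_contour_integral
          (\<Sum>i<n. contour_integral (linepath a b) (g i) * z ^ i)
            + contour_integral (linepath a b) R) (linepath a b)"
        by (intro has_contour_integral_add has_contour_integral_sum R
              has_contour_integral_rmul has_contour_integral_integral g) auto
      moreover have "(\<Sum>i<n. g i w * z ^ i) + R w = f w / (w - z)" if w: "w \<in> ?s" for w
      proof -
        have "(w - z) * (\<Sum>i<n. g i w * z ^ i)
            = f w / poly p w ^ k * ((w - z) * (\<Sum>i<n. poly (q i) w * z ^ i))"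
          by (simp add: g_def sum_distrib_left mult_ac)
        also have "\<dots> = f w / poly p w ^ k * (poly p w ^ k - poly p z ^ k)"
          by (simp add: q[symmetric] poly_power)
        also have "\<dots> = f w - (w - z) * R w"
          using p0[OF w] wz[OF w] by (simp add: R_def power_divide field_simps)
        finally have "(w - z) * ((\<Sum>i<n. g i w * z ^ i) + R w) = f w"
          by (simp add: distrib_left)
        then show ?thesis using wz[OF w] by (simp add: eq_divide_eq mult.commute)
      qed
      ultimately have "((\<lambda>w. f w / (w - z)) has_contour_integral
          (\<Sum>i<n. contour_integral (linepath a b) (g i) * z ^ i)
            + contour_integral (linepath a b) R) (linepath a b)"
        by (rule has_contour_integral_eq) simp
      then have "contour_integral (linepath a b) (\<lambda>w. f w / (w - z))
          - (\<Sum>i<n. contour_integral (linepath a b) (g i) * z ^ i)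
          = contour_integral (linepath a b) R"
        by (simp add: contour_integral_unique)
      moreover have "norm (contour_integral (linepath a b) R) \<le> (M * (1/2) ^ k / e) * norm (b - a)"
      proof (rule has_contour_integral_bound_linepath[OF R])
        show "0 \<le> M * (1/2) ^ k / e" using M(2) e(1) by simp
        fix w assume w: "w \<in> ?s"
        have "norm (poly p z / poly p w) \<le> (1/4) / (1/2)"
          unfolding norm_divide using pw[OF w] pz[OF z] by (intro frac_le) auto
        then have "norm (poly p z / poly p w) \<le> 1/2" by simp
        then show "norm (R w) \<le> M * (1/2) ^ k / e"
          unfolding R_def norm_divide[of "_ * _"] norm_mult norm_power
          using M w S e(1) e(2)[OF w z]
          by (intro frac_le mult_mono power_mono) (auto simp: dist_norm)
      qed
      \<comment> \<open>Rounding n/D down costs less than one block of length \<open>D\<close>, that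
        is, a factor 2; it is the 2 in \<open>C\<close>.\<close>
      moreover have "(1/2) ^ k \<le> 2 * \<rho> ^ n"
      proof -
        have "(1/2) ^ k * (1/2) = \<rho> ^ (k * D + D)"
          unfolding \<rho>(3)[symmetric] power_add power_mult[symmetric] by (simp add: mult.commute)
        also have "\<dots> \<le> \<rho> ^ n" using kn(2) \<rho> by (intro power_decreasing) auto
        finally show ?thesis by simp
      qed
      then have "(M * (1/2) ^ k / e) * norm (b - a) \<le> (M * (2 * \<rho> ^ n) / e) * norm (b - a)"
        using M(2) e(1) by (intro mult_right_mono divide_right_mono mult_left_mono) auto
      ultimately show ?thesis by (simp add: C_def algebra_simps)
    qed
    then show ?thesis
      by (intro exI[of _ "\<lambda>i. contour_integral (linepath a b) (g i)"]) simp
  qed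
  moreover have "0 \<le> C" using e by (simp add: C_def)
  ultimately show ?thesis using \<rho> by (intro geom_approxI[of C \<rho>]) auto
qed

text \<open>A polynomial equal to 1 at one point of the segment is, by continuity, of modulus at
  least 1/2 only near that point. The property is additive under subdivision and holds on short
  pieces around every point, so a bisection argument extends it to the whole segment.\<close>

lemma geom_approx_segment:
  assumes S: "closed_segment a b \<subseteq> S" and E: "compact E" "connected (- E)"
    and disj: "closed_segment a b \<inter> E = {}"
  shows "geom_approx S E (\<lambda>f z. contour_integral (linepath a b) (\<lambda>w. f w / (w - z)))"
proof -
  define \<gamma> where "\<gamma> = linepath a b"
  define T where "T s t f z = contour_integral (linepath (\<gamma> s) (\<gamma> t)) (\<lambda>w. f w / (w - z))"
    for s t and f :: "complex \<Rightarrow> complex" and z :: complex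
  have seg: "closed_segment (\<gamma> s) (\<gamma> t) = \<gamma> ` {s..t}" if "s \<le> t" for s t
  proof -
    have \<gamma>: "\<gamma> = (\<lambda>x. a + x) \<circ> (\<lambda>t. t *\<^sub>R (b - a))"
      by (auto simp: \<gamma>_def linepath_def fun_eq_iff algebra_simps)
    have lin: "linear (\<lambda>t. t *\<^sub>R (b - a))"
      by (intro linearI) (auto simp: algebra_simps)
    have "closed_segment (\<gamma> s) (\<gamma> t) = \<gamma> ` closed_segment s t"
      unfolding \<gamma> o_apply closed_segment_translation closed_segment_linear_image[OF lin]
      by (simp add: image_image)
    then show ?thesis using that by (simp add: closed_segment_eq_real_ivl)
  qed
  have sub: "closed_segment (\<gamma> s) (\<gamma> t) \<subseteq> closed_segment a b" if "0 \<le> s" "s \<le> t" "t \<le> 1" for s t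
    unfolding seg[OF that(2)] using that by (auto simp: \<gamma>_def linepath_in_path)
  \<comment> \<open>The intervals in the premises of \<open>Bolzano\<close> may leave [0, 1], where
    \<open>\<gamma>\<close> runs off the given segment; hence the guards inside
    \<open>P\<close>.\<close>
  have "0 \<le> (0::real) \<longrightarrow> (1::real) \<le> 1 \<longrightarrow> geom_approx S E (T 0 1)"
  proof (rule Bolzano[where P = "\<lambda>s t. 0 \<le> s \<longrightarrow> t \<le> 1 \<longrightarrow> geom_approx S E (T s t)"])
    fix r s t :: real
    assume 1: "0 \<le> r \<longrightarrow> s \<le> 1 \<longrightarrow> geom_approx S E (T r s)"
      and 2: "0 \<le> s \<longrightarrow> t \<le> 1 \<longrightarrow> geom_approx S E (T s t)" and le: "r \<le> s" "s \<le> t"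
    show "0 \<le> r \<longrightarrow> t \<le> 1 \<longrightarrow> geom_approx S E (T r t)"
    proof (intro impI)
      assume rt: "0 \<le> r" "t \<le> 1"
      show "geom_approx S E (T r t)"
      proof (rule geom_approx_cong[OF geom_approx_add])
        show "geom_approx S E (T r s)" "geom_approx S E (T s t)"
          using 1 2 le rt by auto
        fix f :: "complex \<Rightarrow> complex" and z assume f: "continuous_on S f" and z: "z \<in> E"
        have ss: "closed_segment (\<gamma> r) (\<gamma> t) \<subseteq> closed_segment a b"
          using sub le rt by auto
        have "continuous_on (closed_segment (\<gamma> r) (\<gamma> t)) (\<lambda>w. f w / (w - z))"
          using f S ss z disj by (intro continuous_intros continuous_on_subset[OF f]) auto
        moreover have "\<gamma> s \<in> closed_segment (\<gamma> r) (\<gamma> t)"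
          using le by (auto simp: seg)
        ultimately show "T r s f z + T s t f z = T r t f z"
          unfolding T_def by (simp add: contour_integral_split_linepath)
      qed
    qed
  next
    fix x :: real assume x: "0 \<le> x" "x \<le> 1"
    then have "\<gamma> x \<notin> E"
      using disj linepath_in_path[of x a b] unfolding \<gamma>_def by auto
    then obtain p where p: "poly p (\<gamma> x) = 1" "\<And>z. z \<in> E \<Longrightarrow> norm (poly p z) \<le> 1/4"
      using poly_separation[OF E] poly_eq_1_power[OF E(1), of _ "\<gamma> x" "1/4"] by force
    have "isCont (\<lambda>t. poly p (\<gamma> t)) x"
      unfolding \<gamma>_def linepath_def by (intro continuous_intros)
    then obtain d where d: "d > 0" "\<And>t. dist t x < d \<Longrightarrow> dist (poly p (\<gamma> t)) 1 < 1/2"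
      unfolding continuous_at_eps_delta using p(1) by (auto dest: spec[of _ "1/2"])
    show "\<exists>d>0. \<forall>s t. s \<le> x \<and> x \<le> t \<and> t - s < d \<longrightarrow> 0 \<le> s \<longrightarrow> t \<le> 1 \<longrightarrow> geom_approx S E (T s t)"
    proof (intro exI[of _ d] conjI allI impI d(1))
      fix s t assume st: "s \<le> x \<and> x \<le> t \<and> t - s < d" "0 \<le> s" "t \<le> 1"
      then have ss: "closed_segment (\<gamma> s) (\<gamma> t) \<subseteq> closed_segment a b"
        using sub by auto
      show "geom_approx S E (T s t)"
        unfolding T_def
      proof (rule geom_approx_segment_local[where p = p])
        fix w assume "w \<in> closed_segment (\<gamma> s) (\<gamma> t)"
        then obtain u where u: "w = \<gamma> u" "s \<le> u" "u \<le> t"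
          using st by (auto simp: seg)
        then have "dist (poly p w) 1 < 1/2"
          using d(2)[of u] st by (auto simp: dist_real_def)
        then show "1/2 \<le> norm (poly p w)"
          using norm_triangle_ineq2[of 1 "poly p w"] by (simp add: dist_norm norm_minus_commute)
      qed (use ss S disj E p(2) in auto)
    qed
  qed simp
  then show ?thesis by (simp add: T_def[abs_def] \<gamma>_def linepath_0' linepath_1')
qed

section \<open>Cauchy's formula on the boundary of a union of grid squares\<close>

text \<open>Points of \<open>K\<close> on a grid line will be reached as limits of interior points
  of a square, which requires continuity in \<open>z\<close>. A Cauchy integral with continuous
  density is even differentiable off the path.\<close>

lemma isCont_contour_integral_Cauchy_kernel:
  assumes f: "continuous_on (closed_segment a b) f" and z: "z \<notin> closed_segment a b"
  shows "isCont (\<lambda>z. contour_integral (linepath a b) (\<lambda>w. f w / (w - z))) z"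
proof -
  have int: "((\<lambda>w. f w / (w - u) ^ 1) has_contour_integral
      contour_integral (linepath a b) (\<lambda>w. f w / (w - u))) (linepath a b)"
    if "u \<in> UNIV - path_image (linepath a b)" for u
    unfolding power_one_right using that
    by (intro has_contour_integral_integral contour_integrable_continuous_linepath
          continuous_intros f) auto
  show ?thesis
    by (rule DERIV_isCont[OF Cauchy_next_derivative(2)[where k = 1 and S = UNIV
            and f' = f and \<gamma> = "linepath a b" and B = "norm (b - a)", OF _ _ int]])
      (use f z in \<open>auto simp: vector_derivative_linepath_at\<close>)
qed

text \<open>Opposite sides are given the same direction, with signs, so that a side common to two
  adjacent squares appears as one segment with opposite signs.\<close>

lemma contour_integral_rectpath:
  assumes f: "continuous_on (path_image (rectpath a c)) f"
  defines "b \<equiv> Complex (Re c) (Im a)" and "d \<equiv> Complex (Re a) (Im c)"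
  shows "contour_integral (rectpath a c) f
    = contour_integral (linepath a b) f + contour_integral (linepath b c) f
      - contour_integral (linepath d c) f - contour_integral (linepath a d) f"
proof -
  have "path_image (rectpath a c)
      = closed_segment a b \<union> closed_segment b c \<union> closed_segment c d \<union> closed_segment d a"
    by (simp add: rectpath_def Let_def path_image_join Un_assoc b_def d_def)
  then have cont: "continuous_on (closed_segment a b) f" "continuous_on (closed_segment b c) f"
      "continuous_on (closed_segment c d) f" "continuous_on (closed_segment d a) f"
    using f by (auto intro: continuous_on_subset)
  note int = cont[THEN contour_integrable_continuous_linepath]
  have "contour_integral (rectpath a c) f
    = contour_integral (linepath a b) f + (contour_integral (linepath b c) f
      + (contour_integral (linepath c d) f + contour_integral (linepath d a) f))"
    unfolding rectpath_def Let_def b_def[symmetric] d_def[symmetric]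
    using int by (simp add: contour_integral_join)
  also have "contour_integral (linepath c d) f = - contour_integral (linepath d c) f"
    using cont(3) by (rule contour_integral_reverse_linepath)
  also have "contour_integral (linepath d a) f = - contour_integral (linepath a d) f"
    using cont(4) by (rule contour_integral_reverse_linepath)
  finally show ?thesis by simp
qed

text \<open>The algebra of cancelling shared edges: \<open>A\<close> and \<open>B\<close> will index
  the edges counted with sign plus and minus.\<close>

lemma sum_diff_swap:
  fixes g :: "'a \<Rightarrow> 'b :: ab_group_add"
  assumes "finite A" "finite B"
  shows "sum g A - sum g B = sum g (A - B) - sum g (B - A)"
  using sum.Int_Diff[OF assms(1), of g B] sum.Int_Diff[OF assms(2), of g A]
  by (simp add: Int_commute)

text \<open>
  The cycle is the boundary of the union of the squares of a fine grid that meet \<open>K\<close>: an edge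
  shared by two such squares cancels, so no remaining edge meets \<open>K\<close>.
\<close>
lemma Cauchy_formula_segments:
  assumes K: "compact K" and V: "open V" "K \<subseteq> V"
  shows "\<exists>es. (\<forall>(a, b)\<in>set es. closed_segment a b \<subseteq> V - K) \<and>
    (\<forall>f. f holomorphic_on V \<longrightarrow>
      (\<forall>z\<in>K. (\<Sum>(a, b)\<leftarrow>es. contour_integral (linepath a b) (\<lambda>w. f w / (w - z)))
        = 2 * of_real pi * \<i> * f z) \<and>
      (\<forall>z. z \<notin> V \<longrightarrow> (\<Sum>(a, b)\<leftarrow>es. contour_integral (linepath a b) (\<lambda>w. f w / (w - z))) = 0))"
proof -
  obtain e where e: "e > 0" "(\<Union>x\<in>K. ball x e) \<subseteq> V"
    using compact_subset_open_imp_ball_epsilon_subset[OF K V] by blast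
  \<comment> \<open>Two points of a square are at most 2 \<delta> < e apart, so every square meeting
    \<open>K\<close> stays in \<open>V\<close>.\<close>
  define \<delta> where "\<delta> = e / 4"
  have \<delta>: "\<delta> > 0" using e by (simp add: \<delta>_def)
  define pt where "pt i j = Complex (\<delta> * of_int i) (\<delta> * of_int j)" for i j :: int
  define Sq where "Sq i j = cbox (pt i j) (pt (i + 1) (j + 1))" for i j
  have Sq_iff: "w \<in> Sq i j \<longleftrightarrow> \<delta> * of_int i \<le> Re w \<and> Re w \<le> \<delta> * of_int i + \<delta> \<and>
      \<delta> * of_int j \<le> Im w \<and> Im w \<le> \<delta> * of_int j + \<delta>" for w i j
    by (auto simp: Sq_def pt_def in_cbox_complex_iff algebra_simps)
  define S where "S = {(i, j). Sq i j \<inter> K \<noteq> {}}"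
  have SqV: "Sq i j \<subseteq> V" if ij: "(i, j) \<in> S" for i j
  proof
    fix w assume w: "w \<in> Sq i j"
    obtain x where x: "x \<in> Sq i j" "x \<in> K" using ij by (auto simp: S_def)
    have "norm (x - w) \<le> \<bar>Re (x - w)\<bar> + \<bar>Im (x - w)\<bar>" by (rule cmod_le)
    also have "\<dots> \<le> \<delta> + \<delta>"
      using w x unfolding Sq_iff by (intro add_mono) auto
    also have "\<dots> < e" using e by (simp add: \<delta>_def)
    finally have "w \<in> ball x e" by (simp add: dist_norm)
    then show "w \<in> V" using e(2) x(2) by blast
  qed
  have "finite S"
  proof -
    obtain B where B: "\<And>x. x \<in> K \<Longrightarrow> norm x \<le> B"
      using compact_imp_bounded[OF K] by (auto simp: bounded_iff)
    \<comment> \<open>The extra 1 accounts for the side length: the lower left corner of a square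
      may lie \<delta> beyond a point of \<open>K\<close> in it.\<close>
    define m where "m = \<lceil>B / \<delta>\<rceil> + 1"
    have m: "B + \<delta> \<le> \<delta> * of_int m"
    proof -
      have "B / \<delta> \<le> of_int (m - 1)" by (simp add: m_def)
      then show ?thesis using \<delta> by (simp add: field_simps)
    qed
    have "S \<subseteq> {-m..m} \<times> {-m..m}"
    proof clarify
      fix i j assume "(i, j) \<in> S"
      then obtain x where x: "x \<in> Sq i j" "x \<in> K" by (auto simp: S_def)
      have "\<bar>Re x\<bar> \<le> B" "\<bar>Im x\<bar> \<le> B"
        using B[OF x(2)] abs_Re_le_cmod[of x] abs_Im_le_cmod[of x] by linarith+
      then have "\<delta> * of_int i \<le> \<delta> * of_int m" "\<delta> * of_int (- m) \<le> \<delta> * of_int i"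
        "\<delta> * of_int j \<le> \<delta> * of_int m" "\<delta> * of_int (- m) \<le> \<delta> * of_int j"
        using x(1) m \<delta> unfolding Sq_iff of_int_minus mult_minus_right by linarith+
      then show "i \<in> {-m..m} \<and> j \<in> {-m..m}"
        using \<delta> by (simp only: mult_le_cancel_left_pos of_int_le_iff) auto
    qed
    then show ?thesis by (rule finite_subset) auto
  qed
  \<comment> \<open>A horizontal edge carries the index of the square above it, a vertical edge that
    of the square to its right. Thus \<open>S\<close> indexes the bottom and left sides of the
    chosen squares, \<open>up\<close> their top sides and \<open>rt\<close> their right
    sides.\<close>
  define up where "up = (\<lambda>(i, j). (i, j + 1 :: int)) ` S"
  define rt where "rt = (\<lambda>(i, j). (i + 1 :: int, j)) ` S"
  have fin: "finite up" "finite rt" using \<open>finite S\<close> by (auto simp: up_def rt_def)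
  define he where "he = (\<lambda>(i, j). (pt i j, pt (i + 1) j))"
  define ve where "ve = (\<lambda>(i, j). (pt i j, pt i (j + 1)))"
  have he: "closed_segment (pt i j) (pt (i + 1) j) \<subseteq> Sq i j \<inter> Sq i (j - 1)" for i j
  proof -
    have "pt i j \<in> Sq i j" "pt (i + 1) j \<in> Sq i j" "pt i j \<in> Sq i (j - 1)" "pt (i + 1) j \<in> Sq i (j - 1)"
      using \<delta> by (auto simp: Sq_iff pt_def algebra_simps)
    then show ?thesis by (simp add: closed_segment_subset Sq_def)
  qed
  have ve: "closed_segment (pt i j) (pt i (j + 1)) \<subseteq> Sq i j \<inter> Sq (i - 1) j" for i j
  proof -
    have "pt i j \<in> Sq i j" "pt i (j + 1) \<in> Sq i j" "pt i j \<in> Sq (i - 1) j" "pt i (j + 1) \<in> Sq (i - 1) j"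
      using \<delta> by (auto simp: Sq_iff pt_def algebra_simps)
    then show ?thesis by (simp add: closed_segment_subset Sq_def)
  qed
  define L where "L = (\<lambda>A :: (int \<times> int) set. SOME xs. set xs = A \<and> distinct xs)"
  have L: "set (L A) = A" "distinct (L A)" if "finite A" for A
    using someI_ex[OF finite_distinct_list[OF that]] by (auto simp: L_def)
  \<comment> \<open>Top and left sides are reversed, so that the boundary is traversed
    counterclockwise.\<close>
  define es where "es = map he (L (S - up)) @ map (prod.swap \<circ> he) (L (up - S))
    @ map ve (L (rt - S)) @ map (prod.swap \<circ> ve) (L (S - rt))"
  \<comment> \<open>Exactly one of the two squares sharing the edge is in \<open>S\<close>: that one
    places the edge in \<open>V\<close>, the other keeps it off \<open>K\<close>.\<close>
  have edges: "closed_segment (fst (he p)) (snd (he p)) \<subseteq> V - K" if "p \<in> (S - up) \<union> (up - S)" for p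
  proof -
    obtain i j where p: "p = (i, j)" by force
    have "(i, j) \<in> S \<and> (i, j - 1) \<notin> S \<or> (i, j) \<notin> S \<and> (i, j - 1) \<in> S"
      using that by (force simp: up_def p image_iff)
    then show ?thesis
      using he[of i j] SqV[of i j] SqV[of i "j - 1"] by (auto simp: p he_def S_def)
  qed
  have edges': "closed_segment (fst (ve p)) (snd (ve p)) \<subseteq> V - K" if "p \<in> (S - rt) \<union> (rt - S)" for p
  proof -
    obtain i j where p: "p = (i, j)" by force
    have "(i, j) \<in> S \<and> (i - 1, j) \<notin> S \<or> (i, j) \<notin> S \<and> (i - 1, j) \<in> S"
      using that by (force simp: rt_def p image_iff)
    then show ?thesis
      using ve[of i j] SqV[of i j] SqV[of "i - 1" j] by (auto simp: p ve_def S_def)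
  qed
  have es: "closed_segment (fst p) (snd p) \<subseteq> V - K" if "p \<in> set es" for p
  proof -
    have "(\<exists>q\<in>(S - up) \<union> (up - S). p = he q \<or> p = prod.swap (he q)) \<or>
        (\<exists>q\<in>(S - rt) \<union> (rt - S). p = ve q \<or> p = prod.swap (ve q))"
      using that \<open>finite S\<close> fin by (auto simp: es_def L)
    then show ?thesis
      using edges edges' by (metis closed_segment_commute fst_swap snd_swap)
  qed
  define J where "J f z = (\<Sum>(a, b)\<leftarrow>es. contour_integral (linepath a b) (\<lambda>w. f w / (w - z)))"
    for f and z :: complex
  \<comment> \<open>The cancelled edges are put back to regroup the sum by squares. The integrand
    must be continuous on them too, hence the condition that \<open>z\<close> lies on no side of a
    chosen square.\<close>
  have J_eq: "J f z = (\<Sum>(i, j)\<in>S.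
      contour_integral (rectpath (pt i j) (pt (i + 1) (j + 1))) (\<lambda>w. f w / (w - z)))"
    if f: "f holomorphic_on V"
      and z: "\<And>i j. (i, j) \<in> S \<Longrightarrow> z \<notin> path_image (rectpath (pt i j) (pt (i + 1) (j + 1)))" for f z
  proof -
    define F where "F w = f w / (w - z)" for w
    define I where "I = (\<lambda>p. contour_integral (linepath (fst p) (snd p)) F)"
    have cf: "continuous_on V f" using f by (rule holomorphic_on_imp_continuous_on)
    have cont: "continuous_on (path_image (rectpath (pt i j) (pt (i + 1) (j + 1)))) F"
      if "(i, j) \<in> S" for i j
    proof -
      have "path_image (rectpath (pt i j) (pt (i + 1) (j + 1))) \<subseteq> Sq i j"
        unfolding Sq_def using \<delta> by (intro path_image_rectpath_subset_cbox) (auto simp: pt_def)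
      then have "continuous_on (path_image (rectpath (pt i j) (pt (i + 1) (j + 1)))) f"
        using SqV[OF that] cf by (meson continuous_on_subset)
      then show ?thesis
        unfolding F_def using z[OF that] by (intro continuous_intros) auto
    qed
    have rect: "contour_integral (rectpath (pt i j) (pt (i + 1) (j + 1))) F
        = I (he (i, j)) + I (ve (i + 1, j)) - I (he (i, j + 1)) - I (ve (i, j))"
      if "(i, j) \<in> S" for i j
      using contour_integral_rectpath[OF cont[OF that]]
      by (simp add: I_def he_def ve_def pt_def)
    have swap: "I (prod.swap p) = - I p" if "continuous_on (closed_segment (fst p) (snd p)) F" for p
      using contour_integral_reverse_linepath[OF that] by (simp add: I_def)
    have hec: "continuous_on (closed_segment (fst (he p)) (snd (he p))) F" if "p \<in> up - S" for p
    proof -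
      obtain i j where p: "p = (i, j + 1)" "(i, j) \<in> S" using \<open>p \<in> up - S\<close> by (auto simp: up_def)
      show ?thesis
        by (rule continuous_on_subset[OF cont[OF p(2)]])
          (auto simp: p he_def pt_def rectpath_def Let_def path_image_join closed_segment_commute)
    qed
    have vec: "continuous_on (closed_segment (fst (ve p)) (snd (ve p))) F" if "p \<in> S - rt" for p
    proof -
      obtain i j where p: "p = (i, j)" "(i, j) \<in> S" using \<open>p \<in> S - rt\<close> by (cases p) auto
      show ?thesis
        by (rule continuous_on_subset[OF cont[OF p(2)]])
          (auto simp: p he_def ve_def pt_def rectpath_def Let_def path_image_join closed_segment_commute)
    qed
    have inj: "inj_on (\<lambda>(i, j). (i, j + 1 :: int)) S" "inj_on (\<lambda>(i, j). (i + 1 :: int, j)) S"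
      by (auto simp: inj_on_def)
    have Lsum: "(\<Sum>p\<leftarrow>L A. g p) = (\<Sum>p\<in>A. g p)" if "finite A" for A and g :: "int \<times> int \<Rightarrow> complex"
      using L[OF that] by (metis sum_list_distinct_conv_sum_set)
    have "J f z = (\<Sum>p\<leftarrow>es. I p)"
      unfolding J_def by (simp add: I_def F_def[abs_def] case_prod_beta')
    also have "\<dots> = (\<Sum>p\<in>S - up. I (he p)) + (\<Sum>p\<in>up - S. I (prod.swap (he p)))
        + (\<Sum>p\<in>rt - S. I (ve p)) + (\<Sum>p\<in>S - rt. I (prod.swap (ve p)))"
      using \<open>finite S\<close> fin by (simp add: es_def o_def Lsum)
    also have "(\<Sum>p\<in>up - S. I (prod.swap (he p))) = - (\<Sum>p\<in>up - S. I (he p))"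
      using swap hec by (simp add: sum_negf)
    also have "(\<Sum>p\<in>S - rt. I (prod.swap (ve p))) = - (\<Sum>p\<in>S - rt. I (ve p))"
      using swap vec by (simp add: sum_negf)
    finally have "J f z = (\<Sum>p\<in>S. I (he p)) - (\<Sum>p\<in>up. I (he p))
        + ((\<Sum>p\<in>rt. I (ve p)) - (\<Sum>p\<in>S. I (ve p)))"
      unfolding sum_diff_swap[OF \<open>finite S\<close> fin(1)] sum_diff_swap[OF fin(2) \<open>finite S\<close>] by simp
    also have "(\<Sum>p\<in>up. I (he p)) = (\<Sum>(i, j)\<in>S. I (he (i, j + 1)))"
      unfolding up_def by (subst sum.reindex[OF inj(1)]) (simp add: o_def case_prod_beta')
    also have "(\<Sum>p\<in>rt. I (ve p)) = (\<Sum>(i, j)\<in>S. I (ve (i + 1, j)))"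
      unfolding rt_def by (subst sum.reindex[OF inj(2)]) (simp add: o_def case_prod_beta')
    also have "(\<Sum>p\<in>S. I (he p)) - (\<Sum>(i, j)\<in>S. I (he (i, j + 1)))
          + ((\<Sum>(i, j)\<in>S. I (ve (i + 1, j))) - (\<Sum>p\<in>S. I (ve p)))
        = (\<Sum>(i, j)\<in>S. contour_integral (rectpath (pt i j) (pt (i + 1) (j + 1))) F)"
      unfolding sum_subtractf[symmetric] sum.distrib[symmetric]
      by (rule sum.cong) (auto simp: rect)
    finally show ?thesis by (simp add: F_def[abs_def])
  qed
  have path_Sq: "path_image (rectpath (pt i j) (pt (i + 1) (j + 1))) \<subseteq> Sq i j" for i j
    unfolding Sq_def using \<delta> by (intro path_image_rectpath_subset_cbox) (auto simp: pt_def)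
  have rect0: "contour_integral (rectpath (pt i j) (pt (i + 1) (j + 1))) (\<lambda>w. f w / (w - z)) = 0"
    if "f holomorphic_on V" "(i, j) \<in> S" "z \<notin> Sq i j" for f i j z
  proof (rule contour_integral_unique[OF Cauchy_theorem_convex_simple[where S = "Sq i j"]])
    show "(\<lambda>w. f w / (w - z)) holomorphic_on Sq i j"
      using that SqV by (intro holomorphic_intros holomorphic_on_subset[OF that(1)]) auto
  qed (use path_Sq in \<open>auto simp: Sq_def\<close>)
  have J0: "J f z = 0" if f: "f holomorphic_on V" and z: "z \<notin> V" for f z
  proof -
    have out: "z \<notin> Sq i j" if "(i, j) \<in> S" for i j using SqV[OF that] z by blast
    have "z \<notin> path_image (rectpath (pt i j) (pt (i + 1) (j + 1)))" if "(i, j) \<in> S" for i j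
      using out[OF that] path_Sq by blast
    then show ?thesis
      using f out by (subst J_eq) (auto intro!: sum.neutral rect0)
  qed
  \<comment> \<open>Only the square around \<open>z\<close> contributes, with winding number 1; the
    others give 0 by Cauchy's theorem.\<close>
  have J_box: "J f z = 2 * of_real pi * \<i> * f z"
    if f: "f holomorphic_on V" and ij: "(i, j) \<in> S" and z: "z \<in> box (pt i j) (pt (i + 1) (j + 1))"
    for f z i j
  proof -
    have other: "z \<notin> Sq i' j'" if "(i', j') \<noteq> (i, j)" for i' j'
    proof
      assume "z \<in> Sq i' j'"
      then have "\<delta> * of_int i' < \<delta> * of_int (i + 1)" "\<delta> * of_int i < \<delta> * of_int (i' + 1)"
        "\<delta> * of_int j' < \<delta> * of_int (j + 1)" "\<delta> * of_int j < \<delta> * of_int (j' + 1)"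
        using z unfolding Sq_iff by (auto simp: pt_def in_box_complex_iff algebra_simps)
      then have "i' < i + 1" "i < i' + 1" "j' < j + 1" "j < j' + 1"
        using \<delta> by (simp_all only: mult_less_cancel_left_pos of_int_less_iff)
      then show False using that by auto
    qed
    have int: "z \<notin> path_image (rectpath (pt i j) (pt (i + 1) (j + 1)))"
      using z \<delta> by (subst path_image_rectpath_cbox_minus_box) (auto simp: pt_def)
    have off: "z \<notin> path_image (rectpath (pt i' j') (pt (i' + 1) (j' + 1)))" for i' j'
    proof (cases "(i', j') = (i, j)")
      case False
      then show ?thesis using other path_Sq by blast
    qed (use int in simp)
    have "J f z = (\<Sum>(i', j')\<in>S.
        contour_integral (rectpath (pt i' j') (pt (i' + 1) (j' + 1))) (\<lambda>w. f w / (w - z)))"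
      by (rule J_eq[OF f off])
    also have "\<dots> = (\<Sum>(i', j')\<in>{(i, j)}.
        contour_integral (rectpath (pt i' j') (pt (i' + 1) (j' + 1))) (\<lambda>w. f w / (w - z)))"
      using ij \<open>finite S\<close> other f by (intro sum.mono_neutral_right) (auto intro: rect0)
    also have "\<dots> = contour_integral (rectpath (pt i j) (pt (i + 1) (j + 1))) (\<lambda>w. f w / (w - z))"
      by simp
    also have "\<dots> = of_real (2 * pi) * \<i> * winding_number (rectpath (pt i j) (pt (i + 1) (j + 1))) z * f z"
    proof (rule contour_integral_unique[OF Cauchy_integral_formula_convex_simple[where S = "Sq i j"]])
      show "f holomorphic_on Sq i j" using f SqV[OF ij] by (rule holomorphic_on_subset)
      show "z \<in> interior (Sq i j)" using z by (simp add: Sq_def)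
    qed (use path_Sq int in \<open>auto simp: Sq_def\<close>)
    finally show ?thesis using winding_number_rectpath[OF z] by simp
  qed
  have JK: "J f z = 2 * of_real pi * \<i> * f z" if f: "f holomorphic_on V" and z: "z \<in> K" for f z
  proof -
    define i where "i = \<lfloor>Re z / \<delta>\<rfloor>"
    define j where "j = \<lfloor>Im z / \<delta>\<rfloor>"
    have "of_int i \<le> Re z / \<delta>" "Re z / \<delta> \<le> of_int i + 1" "of_int j \<le> Im z / \<delta>" "Im z / \<delta> \<le> of_int j + 1"
      unfolding i_def j_def by linarith+
    then have zS: "z \<in> Sq i j" using \<delta> by (simp add: Sq_iff field_simps)
    then have ij: "(i, j) \<in> S" using z by (auto simp: S_def)
    \<comment> \<open>The centre shows that the open square is nonempty, so its closure is the
      closed square.\<close>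
    have "pt i j + Complex (\<delta>/2) (\<delta>/2) \<in> box (pt i j) (pt (i + 1) (j + 1))"
      using \<delta> by (auto simp: pt_def in_box_complex_iff algebra_simps)
    then have "z \<in> closure (box (pt i j) (pt (i + 1) (j + 1)))"
      using zS by (subst closure_box) (auto simp: Sq_def)
    then obtain x where x: "\<And>n. x n \<in> box (pt i j) (pt (i + 1) (j + 1))" "x \<longlonglongrightarrow> z"
      unfolding closure_sequential by blast
    have "isCont (\<lambda>z. \<Sum>(a, b)\<leftarrow>xs. contour_integral (linepath a b) (\<lambda>w. f w / (w - z))) z"
      if "set xs \<subseteq> set es" for xs
      using that
    proof (induction xs)
      case (Cons p xs)
      have p: "closed_segment (fst p) (snd p) \<subseteq> V - K" using Cons.prems es by simp
      have "continuous_on (closed_segment (fst p) (snd p)) f"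
        using p holomorphic_on_imp_continuous_on[OF f] continuous_on_subset by blast
      then have "isCont (\<lambda>z. contour_integral (linepath (fst p) (snd p)) (\<lambda>w. f w / (w - z))) z"
        using p z by (intro isCont_contour_integral_Cauchy_kernel) auto
      then show ?case using Cons by (simp add: case_prod_beta')
    qed simp
    then have "isCont (J f) z" unfolding J_def by blast
    moreover have "isCont f z"
      using f z V holomorphic_on_imp_continuous_on[OF f] continuous_on_eq_continuous_at by blast
    ultimately have "isCont (\<lambda>z. J f z - 2 * of_real pi * \<i> * f z) z"
      by (intro continuous_intros)
    then have "(\<lambda>n. J f (x n) - 2 * of_real pi * \<i> * f (x n)) \<longlonglongrightarrow> J f z - 2 * of_real pi * \<i> * f z"
      using x(2) isCont_tendsto_compose by blast
    then have "(\<lambda>n. 0) \<longlonglongrightarrow> J f z - 2 * of_real pi * \<i> * f z"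
      using J_box[OF f ij x(1)] by simp
    then show ?thesis using LIMSEQ_unique tendsto_const by fastforce
  qed
  show ?thesis
    using es J0 JK unfolding J_def by (intro exI[of _ es]) (auto simp: case_prod_beta')
qed

section \<open>Approximation along the cycle, supremum norms and absorption of constants\<close>

lemma geom_approx_sum_segments:
  assumes E: "compact E" "connected (- E)"
    and es: "\<And>a b. (a, b) \<in> set es \<Longrightarrow> closed_segment a b \<subseteq> S - E"
  shows "geom_approx S E (\<lambda>f z. \<Sum>(a, b)\<leftarrow>es. contour_integral (linepath a b) (\<lambda>w. f w / (w - z)))"
  using es
proof (induction es)
  case Nil
  then show ?case by (simp add: geom_approx_0)
next
  case (Cons p es)
  obtain a b where p: "p = (a, b)" by force
  have "closed_segment a b \<subseteq> S - E" using Cons.prems[of a b] p by simp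
  then have "geom_approx S E (\<lambda>f z. contour_integral (linepath a b) (\<lambda>w. f w / (w - z)))"
    by (intro geom_approx_segment E) auto
  then show ?case
    using geom_approx_add Cons by (simp add: p)
qed

lemma norm_le_sup_norm:
  assumes "compact X" "continuous_on X f" "z \<in> X"
  shows "norm (f z) \<le> sup_norm X f"
proof -
  have "compact ((\<lambda>z. norm (f z)) ` X)"
    using assms by (intro compact_continuous_image continuous_intros)
  then have "bdd_above ((\<lambda>z. norm (f z)) ` X)"
    by (intro bounded_imp_bdd_above compact_imp_bounded)
  then show ?thesis
    using assms(3) by (auto simp: sup_norm_def intro: cSUP_upper)
qed

lemma sup_norm_nonneg:
  assumes "compact X" "continuous_on X f"
  shows "0 \<le> sup_norm X f"
proof (cases "X = {}")
  case False
  then show ?thesis using norm_le_sup_norm[OF assms] norm_ge_zero order_trans by blast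
qed (simp add: sup_norm_def)

lemma sup_norm_le:
  assumes "0 \<le> B" "\<And>z. z \<in> X \<Longrightarrow> norm (f z) \<le> B"
  shows "sup_norm X f \<le> B"
  using assms by (auto simp: sup_norm_def intro: cSUP_least)

text \<open>Once \<sigma>^T is at most 1/B, the product is at most (B \<sigma>^T)^m. This
  \<open>T\<close> will serve as \<tau>.\<close>

lemma obtain_power_absorbing:
  fixes \<sigma> B :: real
  assumes "0 < \<sigma>" "\<sigma> < 1" "1 \<le> B"
  obtains T :: nat where "1 \<le> T" "\<And>m n. m * T \<le> n \<Longrightarrow> B ^ m * \<sigma> ^ n \<le> 1"
proof -
  obtain t where t: "\<sigma> ^ t < 1 / B"
    using real_arch_pow_inv[of "1 / B" \<sigma>] assms by auto
  define T where "T = Suc t"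
  have "\<sigma> ^ T \<le> \<sigma> ^ t" unfolding T_def using assms by (intro power_decreasing) auto
  then have "\<sigma> ^ T \<le> 1 / B" using t by linarith
  then have BT: "B * \<sigma> ^ T \<le> 1" using assms by (simp add: field_simps)
  have "B ^ m * \<sigma> ^ n \<le> 1" if "m * T \<le> n" for m n
  proof -
    have "B ^ m * \<sigma> ^ n \<le> B ^ m * \<sigma> ^ (m * T)"
      using that assms by (intro mult_left_mono power_decreasing) auto
    also have "\<dots> = (B * \<sigma> ^ T) ^ m"
      by (simp add: power_mult_distrib power_mult[symmetric] mult.commute)
    also have "\<dots> \<le> 1" using BT assms by (intro power_le_one) auto
    finally show ?thesis .
  qed
  then show thesis by (intro that[of T]) (simp add: T_def)
qed

section \<open>Choice of the constants and construction of the polynomial\<close>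

theorem theoremC:
  fixes K L U :: "complex set"
  assumes "compact K" and "compact L"
    and "K \<subseteq> UNIV - {0}"
    and "K \<inter> L = {}"
    and "connected (UNIV - K)" and "connected (UNIV - L)"
    and "open U" and "bounded U" and "K \<subseteq> U"
  shows "\<exists>(\<tau>::real) (\<theta>::real) (N::nat). 1 \<le> \<tau> \<and> 0 < \<theta> \<and> \<theta> < 1 \<and>
    (\<forall>\<phi> \<in> A_space (closure U). \<forall>n\<ge>N.
      \<exists>(P::complex poly) (a::nat \<Rightarrow> complex).
        P = (\<Sum>k = nat \<lfloor>real n / \<tau>\<rfloor>..n. monom (a k) k) \<and>
        sup_norm L (poly P) \<le> sup_norm (closure U) \<phi> * \<theta> ^ n \<and>
        sup_norm K (\<lambda>z. poly P z - \<phi> z) \<le> sup_norm (closure U) \<phi> * \<theta> ^ n)"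
proof -
  define E where "E = K \<union> L"
  \<comment> \<open>By Janiszewski's theorem, compact sets with connected complements and connected
    intersection, here empty, have a union with connected complement.\<close>
  have E: "compact E" "connected (- E)"
    unfolding E_def using assms
    by (auto simp: Compl_eq_Diff_UNIV compact_imp_closed
        intro!: compact_Un Janiszewski_connected[unfolded Compl_eq_Diff_UNIV])
  \<comment> \<open>Removing \<open>L\<close> makes the Cauchy integral vanish there; removing 0
    makes division by powers of w holomorphic.\<close>
  define V where "V = U - L - {0}"
  have V: "open V" "K \<subseteq> V"
    using assms by (auto simp: V_def intro!: open_Diff compact_imp_closed)
  obtain es where es: "\<And>a b. (a, b) \<in> set es \<Longrightarrow> closed_segment a b \<subseteq> V - K"
    and formula: "\<And>f z. f holomorphic_on V \<Longrightarrow> z \<in> K \<Longrightarrow>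
        (\<Sum>(a, b)\<leftarrow>es. contour_integral (linepath a b) (\<lambda>w. f w / (w - z))) = 2 * of_real pi * \<i> * f z"
    and formula0: "\<And>f z. f holomorphic_on V \<Longrightarrow> z \<notin> V \<Longrightarrow>
        (\<Sum>(a, b)\<leftarrow>es. contour_integral (linepath a b) (\<lambda>w. f w / (w - z))) = 0"
    using Cauchy_formula_segments[OF assms(1) V] by fast
  define J where "J f z = (\<Sum>(a, b)\<leftarrow>es. contour_integral (linepath a b) (\<lambda>w. f w / (w - z)))"
    for f and z :: complex
  define S where "S = (\<Union>(a, b)\<in>set es. closed_segment a b)"
  have S: "compact S" "S \<subseteq> V"
    using es by (auto simp: S_def)
  have "geom_approx S E J"
    unfolding J_def[abs_def]
  proof (rule geom_approx_sum_segments[OF E])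
    fix a b assume "(a, b) \<in> set es"
    then show "closed_segment a b \<subseteq> S - E"
      using es[of a b] by (force simp: S_def E_def V_def)
  qed
  then obtain C \<rho> where C: "0 \<le> C" and \<rho>: "0 < \<rho>" "\<rho> < 1"
    and approx: "\<And>f M n. \<lbrakk>continuous_on S f; \<And>w. w \<in> S \<Longrightarrow> norm (f w) \<le> M; 0 \<le> M\<rbrakk> \<Longrightarrow>
      \<exists>c. \<forall>z\<in>E. norm (J f z - (\<Sum>i<n. c i * z ^ i)) \<le> C * M * \<rho> ^ n"
    by (rule geom_approxE) blast
  obtain \<delta> where \<delta>: "0 < \<delta>" "\<And>w. w \<in> S \<Longrightarrow> \<delta> \<le> norm w"
    using separate_point_closed[OF compact_imp_closed[OF S(1)], of 0] S(2) by (auto simp: V_def)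
  obtain R where R: "0 < R" "\<And>z. z \<in> E \<Longrightarrow> norm z \<le> R"
    using compact_imp_bounded[OF E(1)] by (auto simp: bounded_pos)
  \<comment> \<open>Per unit of \<open>m\<close>, multiplication by z^m costs \<open>R\<close>,
    division by w^m costs 1/\<delta>, and the loss of \<open>m\<close> available degrees costs
    1/\<rho>.\<close>
  define B where "B = max 1 (R / (\<delta> * \<rho>))"
  \<comment> \<open>The rate is split twice: of \<rho>^n = \<sigma>^n \<sigma>^n one factor absorbs
    B^m, and of \<sigma>^n = \<theta>^n \<theta>^n one factor absorbs \<open>C\<close> once n is at
    least \<open>N\<close>.\<close>
  define \<sigma> where "\<sigma> = sqrt \<rho>"
  define \<theta> where "\<theta> = sqrt \<sigma>"
  have \<sigma>: "0 < \<sigma>" "\<sigma> < 1" "\<sigma> * \<sigma> = \<rho>" using \<rho> by (auto simp: \<sigma>_def)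
  have \<theta>: "0 < \<theta>" "\<theta> < 1" "\<theta> * \<theta> = \<sigma>" using \<sigma> by (auto simp: \<theta>_def)
  obtain T where T: "1 \<le> T" "\<And>m n. m * T \<le> n \<Longrightarrow> B ^ m * \<sigma> ^ n \<le> 1"
    using obtain_power_absorbing[OF \<sigma>(1,2), of B] by (auto simp: B_def)
  obtain N where N: "\<theta> ^ N < 1 / (C + 1)"
    using real_arch_pow_inv[of "1 / (C + 1)" \<theta>] C \<theta> by auto
  have "\<exists>P a. P = (\<Sum>k = nat \<lfloor>real n / real T\<rfloor>..n. monom (a k) k) \<and>
        sup_norm L (poly P) \<le> sup_norm (closure U) \<phi> * \<theta> ^ n \<and>
        sup_norm K (\<lambda>z. poly P z - \<phi> z) \<le> sup_norm (closure U) \<phi> * \<theta> ^ n"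
    if \<phi>: "\<phi> \<in> A_space (closure U)" and n: "N \<le> n" for \<phi> n
  proof -
    define M where "M = sup_norm (closure U) \<phi>"
    have cl: "compact (closure U)" "continuous_on (closure U) \<phi>"
      using \<phi> \<open>bounded U\<close> by (auto simp: A_space_def compact_closure)
    have M: "0 \<le> M" "\<And>z. z \<in> U \<Longrightarrow> norm (\<phi> z) \<le> M"
      unfolding M_def using sup_norm_nonneg[OF cl] norm_le_sup_norm[OF cl] closure_subset by auto
    define m where "m = n div T"
    have m: "nat \<lfloor>real n / real T\<rfloor> = m" "m * T \<le> n"
      by (auto simp: m_def floor_divide_of_nat_eq)
    have mn: "m \<le> n" using m(2) T(1) by (metis div_le_dividend m_def)
    define f where "f w = \<phi> w / w ^ m" for w
    have "U \<subseteq> interior (closure U)"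
      using \<open>open U\<close> closure_subset by (rule interior_maximal[rotated])
    then have "\<phi> holomorphic_on V"
      using \<phi> by (auto simp: A_space_def V_def elim!: holomorphic_on_subset)
    then have f: "f holomorphic_on V"
      unfolding f_def by (intro holomorphic_intros) (auto simp: V_def)
    have "norm (f w) \<le> M / \<delta> ^ m" if "w \<in> S" for w
    proof -
      have "w \<in> U" using that S(2) by (auto simp: V_def)
      then show ?thesis
        unfolding f_def norm_divide norm_power
        using M \<delta> that by (intro frac_le power_mono zero_less_power) auto
    qed
    moreover have "continuous_on S f"
      using S(2) holomorphic_on_imp_continuous_on[OF f] continuous_on_subset by blast
    moreover have "0 \<le> M / \<delta> ^ m" using M \<delta> by simp
    \<comment> \<open>Taking n - m + 1 coefficients makes the exponents run exactly from
      \<open>m\<close> to \<open>n\<close> after multiplication by z^m.\<close>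
    ultimately obtain c where c: "\<And>z. z \<in> E \<Longrightarrow>
        norm (J f z - (\<Sum>i<Suc (n - m). c i * z ^ i)) \<le> C * (M / \<delta> ^ m) * \<rho> ^ Suc (n - m)"
      using approx[of f "M / \<delta> ^ m" "Suc (n - m)"] by blast
    define a where "a k = c (k - m) / (2 * of_real pi * \<i>)" for k
    define P where "P = (\<Sum>k = m..n. monom (a k) k)"
    have P: "poly P z = z ^ m * (\<Sum>i<Suc (n - m). c i * z ^ i) / (2 * of_real pi * \<i>)" for z
    proof -
      have "poly P z = (\<Sum>k = m..n. a k * z ^ k)"
        by (simp add: P_def poly_sum poly_monom)
      also have "\<dots> = (\<Sum>i\<le>n - m. a (m + i) * z ^ (m + i))"
        using mn by (simp add: sum.atLeastAtMost_shift_0 atLeast0AtMost)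
      also have "\<dots> = (\<Sum>i\<le>n - m. z ^ m * (c i * z ^ i) / (2 * of_real pi * \<i>))"
        by (intro sum.cong) (auto simp: a_def power_add)
      finally show ?thesis
        by (simp only: sum_distrib_left sum_divide_distrib lessThan_Suc_atMost)
    qed
    have "C * \<theta> ^ n \<le> 1"
    proof -
      have "C * \<theta> ^ n \<le> (C + 1) * \<theta> ^ N"
        using C n \<theta> by (intro mult_mono power_decreasing) auto
      also have "\<dots> \<le> 1" using N C by (simp add: field_simps)
      finally show ?thesis .
    qed
    then have "(C * \<theta> ^ n) * (M * \<theta> ^ n) \<le> M * \<theta> ^ n"
      using M \<theta> by (intro mult_left_le_one_le) (auto simp: C)
    then have C\<sigma>: "C * M * \<sigma> ^ n \<le> M * \<theta> ^ n"
      by (simp add: \<theta>(3)[symmetric] power_mult_distrib mult_ac)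
    \<comment> \<open>One estimate serves both sets: the comparison term z^m J f(z) / (2 pi i) is 0
      on \<open>L\<close> and \<phi>(z) on \<open>K\<close>.\<close>
    have bound: "norm (poly P z - z ^ m * J f z / (2 * of_real pi * \<i>)) \<le> M * \<theta> ^ n"
      if z: "z \<in> E" for z
    proof -
      have "poly P z - z ^ m * J f z / (2 * of_real pi * \<i>)
          = z ^ m * ((\<Sum>i<Suc (n - m). c i * z ^ i) - J f z) / (2 * of_real pi * \<i>)"
        unfolding P by (simp only: right_diff_distrib diff_divide_distrib)
      then have "norm (poly P z - z ^ m * J f z / (2 * of_real pi * \<i>))
          = norm z ^ m * norm (J f z - (\<Sum>i<Suc (n - m). c i * z ^ i)) / (2 * pi)"
        by (simp only: norm_mult norm_divide norm_power norm_minus_commute) simp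
      also have "\<dots> \<le> norm z ^ m * norm (J f z - (\<Sum>i<Suc (n - m). c i * z ^ i)) / 1"
        using pi_gt3 by (intro divide_left_mono) auto
      also have "\<dots> \<le> R ^ m * (C * (M / \<delta> ^ m) * \<rho> ^ Suc (n - m))"
        unfolding div_by_1 using R z by (intro mult_mono power_mono c) auto
      also have "\<dots> \<le> R ^ m * (C * (M / \<delta> ^ m) * \<rho> ^ (n - m))"
        using R C M \<delta> \<rho> by (intro mult_left_mono power_decreasing) auto
      also have "\<dots> = C * M * ((R / (\<delta> * \<rho>)) ^ m * \<rho> ^ n)"
        using \<delta> \<rho> mn by (simp add: power_diff power_divide power_mult_distrib)
      also have "\<dots> \<le> C * M * (B ^ m * \<rho> ^ n)"
        using R C M \<delta> \<rho> by (intro mult_left_mono mult_right_mono power_mono) (auto simp: B_def)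
      also have "\<dots> = C * M * \<sigma> ^ n * (B ^ m * \<sigma> ^ n)"
        by (simp add: \<sigma>(3)[symmetric] power_mult_distrib)
      also have "\<dots> \<le> C * M * \<sigma> ^ n"
        using T(2)[OF m(2)] C M \<sigma> by (intro mult_right_le_one_le) (auto simp: B_def)
      finally show ?thesis using C\<sigma> by linarith
    qed
    have M\<theta>: "0 \<le> M * \<theta> ^ n" using M \<theta> by simp
    have "sup_norm L (poly P) \<le> M * \<theta> ^ n"
    proof (rule sup_norm_le[OF M\<theta>])
      fix z assume z: "z \<in> L"
      then have "J f z = 0" using formula0[OF f] by (simp add: J_def V_def)
      then show "norm (poly P z) \<le> M * \<theta> ^ n" using bound[of z] z by (simp add: E_def)
    qed
    moreover have "sup_norm K (\<lambda>z. poly P z - \<phi> z) \<le> M * \<theta> ^ n"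
    proof (rule sup_norm_le[OF M\<theta>])
      fix z assume z: "z \<in> K"
      then have "J f z = 2 * of_real pi * \<i> * f z" using formula[OF f] by (simp add: J_def)
      moreover have "z \<noteq> 0" using z assms(3) by auto
      ultimately have "z ^ m * J f z / (2 * of_real pi * \<i>) = \<phi> z"
        by (simp add: f_def)
      then show "norm (poly P z - \<phi> z) \<le> M * \<theta> ^ n" using bound[of z] z by (simp add: E_def)
    qed
    ultimately show ?thesis
      unfolding m(1) M_def[symmetric] using P_def by blast
  qed
  then show ?thesis
    using T(1) \<theta>
    by (intro exI[of _ "real T"] exI[of _ \<theta>] exI[of _ N]) auto
qed

end
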